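(* Let $C\subset\mathbb{F}_2^n$ be any binary linear code, let $d\ge 0$ be an integer, and let $Q\in\mathcal{D}_d^0$ be a discrete harmonic polynomial of degree $d$. Then the harmonic weight enumerator $W_{C,Q}(x,y)=\sum_{c\in C}Q(c)x^{n-\mathrm{wt}(c)}y^{\mathrm{wt}(c)}$ satisfies the identity $$W_{C,Q}(x,y)=\left(-\frac{xy}{x^2-y^2}\right)^{d}\cdot\frac{2^{\frac n2+d}}{|C^\perp|}\cdot W_{C^\perp,Q}\left(\frac{x+y}{\sqrt2},\frac{x-y}{\sqrt2}\right).$$
   Context: A binary linear code of length $n$ is a vector subspace $C\subseteq\mathbb{F}_2^n$; $\mathrm{wt}(c)$ is the number of nonzero coordinates of $c$; $C^\perp$ is the annihilator of $C$ with respect to $(v,w)=\sum_j v_jw_j$ on $\mathbb{F}_2^n$. For any code $C$ and function $Q:\mathbb{F}_2^n\to\mathbb{C}$, $W_{C,Q}(x,y):=\sum_{c\in C}Q(c)x^{n-\mathrm{wt}(c)}y^{\mathrm{wt}(c)}$. Discrete harmonic polynomials: functions $\mathbb{F}_2^n\to\mathbb{C}$ are identified with $(\mathbb{C}^2)^{\otimes n}$, the pure tensor $\binom{g_{10}}{g_{11}}\otimes\cdots\otimes\binom{g_{n0}}{g_{n1}}$ being the function $v\mapsto g_{1v_1}\cdots g_{nv_n}$. Let $\mathcal{D}_d$ be the complex span of the functions $v\mapsto\prod_{j\in J}(-1)^{v_j}$ with $J\subseteq\{1,\dots,n\}$, $|J|=d$ ($\mathcal{D}_d=\{0\}$ for $d<0$).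 Let $X'=\tfrac12\begin{pmatrix}1&-1\\1&-1\end{pmatrix}$ and $\tilde X'=\sum_{j=1}^n I\otimes\cdots\otimes X'\otimes\cdots\otimes I$ ($X'$ in the $j$-th factor). Then $\tilde X'$ maps $\mathcal{D}_d$ to $\mathcal{D}_{d-1}$, and $\mathcal{D}_d^0:=\ker(\tilde X':\mathcal{D}_d\to\mathcal{D}_{d-1})$ is the space of degree-$d$ discrete harmonic polynomials. *)

theory Defs
  imports "HOL-Analysis.Analysis" "HOL-Library.Z2" "HOL-Library.Function_Algebras"
begin

text \<open>
  \<^typ>\<open>bit\<close> is the two-element field and \<^typ>\<open>bit ^ 'n\<close> is the space of binary words of
  length \<open>n = CARD('n)\<close>. A binary linear code is a \<^term>\<open>C :: (bit ^ 'n) set\<close> with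
  \<^term>\<open>vec.subspace C\<close>.
\<close>

instance bit :: finite
proof
  have "(UNIV :: bit set) = {0, 1}"
    by auto
  then show "finite (UNIV :: bit set)"
    by (metis finite.emptyI finite.insertI)
qed

definition wt :: "bit ^ 'n \<Rightarrow> nat"
  where "wt c = card {j. c $ j \<noteq> 0}"

definition dual_code :: "(bit ^ 'n) set \<Rightarrow> (bit ^ 'n) set"
  where "dual_code C = {w. \<forall>v\<in>C. (\<Sum>j\<in>UNIV. v $ j * w $ j) = 0}"

definition weight_enum ::
  "(bit ^ 'n) set \<Rightarrow> (bit ^ 'n \<Rightarrow> complex) \<Rightarrow> complex \<Rightarrow> complex \<Rightarrow> complex"
  where "weight_enum C Q x y = (\<Sum>c\<in>C. Q c * x ^ (CARD('n) - wt c) * y ^ wt c)"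

text \<open>The complex vector space of functions on binary words.\<close>

definition fun_scale :: "complex \<Rightarrow> ('a \<Rightarrow> complex) \<Rightarrow> 'a \<Rightarrow> complex"
  where "fun_scale a f = (\<lambda>v. a * f v)"

interpretation cfun: vector_space "fun_scale :: complex \<Rightarrow> ('a \<Rightarrow> complex) \<Rightarrow> 'a \<Rightarrow> complex"
  by unfold_locales (auto simp: fun_scale_def fun_eq_iff algebra_simps)

text \<open>
  Functions on \<^typ>\<open>bit ^ 'n\<close> are identified with the \<open>n\<close>-fold tensor power of
  \<^typ>\<open>complex ^ bit\<close>. In this picture \<open>on_factor j A\<close> is
  \<open>I \<otimes> \<dots> \<otimes> A \<otimes> \<dots> \<otimes> I\<close> with \<open>A\<close> in the factor \<open>j\<close>; lemma \<open>on_factor_pure_tensor\<close> confirms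
  this.
\<close>

definition pure_tensor :: "('n \<Rightarrow> complex ^ bit) \<Rightarrow> bit ^ 'n \<Rightarrow> complex"
  where "pure_tensor g v = (\<Prod>j\<in>UNIV. g j $ (v $ j))"

definition on_factor ::
  "'n \<Rightarrow> complex ^ bit ^ bit \<Rightarrow> (bit ^ 'n \<Rightarrow> complex) \<Rightarrow> bit ^ 'n \<Rightarrow> complex"
  where "on_factor j A f v = (A *v (\<chi> b. f (\<chi> i. if i = j then b else v $ i))) $ (v $ j)"

lemma on_factor_pure_tensor:
  fixes j :: "'n::finite" and g :: "'n \<Rightarrow> complex ^ bit"
  shows "on_factor j A (pure_tensor g) = pure_tensor (g(j := A *v g j))"
proof
  fix v :: "bit ^ 'n"
  let ?r = "\<Prod>i\<in>UNIV - {j}. g i $ (v $ i)"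
  have L: "pure_tensor g (\<chi> i. if i = j then b else v $ i) = g j $ b * ?r" for b
    unfolding pure_tensor_def
    by (subst prod.remove[of _ j]) (auto intro!: prod.cong)
  have R: "pure_tensor (g(j := A *v g j)) v = (A *v g j) $ (v $ j) * ?r"
    unfolding pure_tensor_def
    by (subst prod.remove[of _ j]) (auto intro!: prod.cong)
  show "on_factor j A (pure_tensor g) v = pure_tensor (g(j := A *v g j)) v"
    unfolding R
    by (simp add: on_factor_def L matrix_vector_mult_def sum_distrib_right mult.assoc)
qed

text \<open>The matrix \<open>X'\<close> has both rows equal to \<open>(1/2, -1/2)\<close>.\<close>

definition X' :: "complex ^ bit ^ bit"
  where "X' = (\<chi> r c. if c = 0 then 1/2 else - 1/2)"

definition X'_tilde :: "(bit ^ 'n \<Rightarrow> complex) \<Rightarrow> bit ^ 'n \<Rightarrow> complex"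
  where "X'_tilde f v = (\<Sum>j\<in>UNIV. on_factor j X' f v)"

definition sign_char :: "'n set \<Rightarrow> bit ^ 'n \<Rightarrow> complex"
  where "sign_char J v = (\<Prod>j\<in>J. if v $ j = 0 then 1 else - 1)"

definition disc_poly :: "nat \<Rightarrow> (bit ^ 'n \<Rightarrow> complex) set"
  where "disc_poly d = cfun.span {sign_char J | J. card J = d}"

text \<open>
  The codomain of \<open>X'_tilde\<close> restricted to \<open>disc_poly d\<close> plays no role in the kernel; that it is
  \<open>disc_poly (d - 1)\<close>, and the zero space for \<open>d = 0\<close>, is shown in \<open>X'_tilde_disc_poly_Suc\<close> and
  \<open>X'_tilde_disc_poly_0\<close>.
\<close>

definition disc_harmonic :: "nat \<Rightarrow> (bit ^ 'n \<Rightarrow> complex) set"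
  where "disc_harmonic d = {Q \<in> disc_poly d. X'_tilde Q = 0}"

lemma sum_apply: "(\<Sum>j\<in>J. F j) v = (\<Sum>j\<in>J. F j v)"
  for F :: "'j \<Rightarrow> 'a \<Rightarrow> complex"
  by (induction J rule: infinite_finite_induct) auto

lemma UNIV_bit: "(UNIV :: bit set) = {0, 1}"
  by auto

lemma X'_tilde_add: "X'_tilde (f + g) = X'_tilde f + X'_tilde g"
  by (simp add: X'_tilde_def on_factor_def fun_eq_iff matrix_vector_mult_def UNIV_bit
      algebra_simps sum.distrib)

lemma X'_tilde_scale: "X'_tilde (fun_scale a f) = fun_scale a (X'_tilde f)"
  by (simp add: X'_tilde_def on_factor_def fun_scale_def fun_eq_iff matrix_vector_mult_def UNIV_bit
      sum_distrib_left algebra_simps)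

lemma on_factor_X'_sign_char:
  fixes j :: "'n::finite"
  shows "on_factor j X' (sign_char J) = (if j \<in> J then sign_char (J - {j}) else 0)"
proof
  fix v :: "bit ^ 'n"
  show "on_factor j X' (sign_char J) v = (if j \<in> J then sign_char (J - {j}) else 0) v"
  proof (cases "j \<in> J")
    case True
    have "sign_char J (\<chi> i. if i = j then b else v $ i)
        = (if b = 0 then 1 else - 1) * sign_char (J - {j}) v" for b
      unfolding sign_char_def using True
      by (subst prod.remove[of _ j]) (auto intro!: prod.cong)
    then show ?thesis
      using True by (simp add: on_factor_def matrix_vector_mult_def UNIV_bit X'_def)
  next
    case False
    have "sign_char J (\<chi> i. if i = j then b else v $ i) = sign_char J v" for b
      unfolding sign_char_def using False by (auto intro!: prod.cong)
    then show ?thesis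
      using False by (simp add: on_factor_def matrix_vector_mult_def UNIV_bit X'_def)
  qed
qed

lemma X'_tilde_sign_char:
  fixes J :: "'n::finite set"
  shows "X'_tilde (sign_char J) = (\<Sum>j\<in>J. sign_char (J - {j}))"
proof
  fix v :: "bit ^ 'n"
  have "X'_tilde (sign_char J) v = (\<Sum>j\<in>UNIV. if j \<in> J then sign_char (J - {j}) v else 0)"
    by (auto simp: X'_tilde_def on_factor_X'_sign_char intro!: sum.cong)
  also have "\<dots> = (\<Sum>j\<in>J. sign_char (J - {j}) v)"
    by (simp flip: sum.inter_restrict)
  also have "\<dots> = (\<Sum>j\<in>J. sign_char (J - {j})) v"
    by (rule sum_apply [symmetric])
  finally show "X'_tilde (sign_char J) v = (\<Sum>j\<in>J. sign_char (J - {j})) v" .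
qed

lemma X'_tilde_zero: "X'_tilde 0 = 0"
  using X'_tilde_scale[of 0 0] by (metis cfun.scale_zero_left)

lemma X'_tilde_disc_poly_Suc:
  assumes "f \<in> disc_poly (Suc d)"
  shows "X'_tilde f \<in> disc_poly d"
  using assms unfolding disc_poly_def
proof (induction rule: cfun.span_induct_alt)
  case base
  show ?case
    using cfun.span_zero X'_tilde_zero by (metis (no_types))
next
  case (step c g h)
  then obtain J where J: "g = sign_char J" "card J = Suc d"
    by blast
  have "X'_tilde g \<in> cfun.span {sign_char J | J. card J = d}"
    unfolding J(1) X'_tilde_sign_char
    by (rule cfun.span_sum, rule cfun.span_base) (use J(2) in auto)
  with step show ?case
    by (simp only: X'_tilde_add X'_tilde_scale cfun.span_add cfun.span_scale)
qed

lemma X'_tilde_disc_poly_0: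
  assumes "f \<in> disc_poly 0"
  shows "X'_tilde f = 0"
  using assms unfolding disc_poly_def
proof (induction rule: cfun.span_induct_alt)
  case base
  show ?case
    by (rule X'_tilde_zero)
next
  case (step c g h)
  then have "g = sign_char {}"
    by auto
  then have "X'_tilde g = 0"
    by (simp add: X'_tilde_sign_char)
  with step show ?case
    by (simp only: X'_tilde_add X'_tilde_scale cfun.scale_zero_right add_0)
qed

end

theory Submission
  imports Defs
begin

text \<open>
  The weighted Fourier transform, as an operator on \<open>n\<close>-fold tensors, is the \<open>n\<close>-th tensor power
  of a \<open>2 \<times> 2\<close> matrix which, up to a factor \<open>x \<plusminus> y\<close> in each row, fixes the constant function
  and sends the sign function \<open>s\<close> to \<open>\<alpha> + \<beta> s\<close> with \<open>\<beta> = - 2 x y / (x\<^sup>2 - y\<^sup>2)\<close>. If the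
  constant \<open>\<alpha>\<close> is replaced by a variable \<open>t\<close>, differentiating the tensor power in \<open>t\<close> amounts
  to composing it with \<open>X'_tilde\<close>. On a harmonic \<open>Q\<close> the result is therefore independent of
  \<open>t\<close>, and at \<open>t = 0\<close> it is \<open>\<beta> ^ d * Q\<close>. Poisson summation over the code does the rest.
\<close>

section \<open>Signs of bits and products over coordinates\<close>

definition bit_sign :: "bit \<Rightarrow> complex"
  where "bit_sign b = (if b = 0 then 1 else - 1)"

lemma bit_sign_simps [simp]: "bit_sign 0 = 1" "bit_sign 1 = - 1"
  by (simp_all add: bit_sign_def)

lemma bit_sign_eq_1_iff: "bit_sign b = 1 \<longleftrightarrow> b = 0"
  by (simp add: bit_sign_def)

lemma bit_sign_add: "bit_sign (a + b) = bit_sign a * bit_sign b"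
  by (cases a; cases b) simp_all

lemma bit_sign_sum: "bit_sign (\<Sum>j\<in>J. f j) = (\<Prod>j\<in>J. bit_sign (f j))"
  by (induction J rule: infinite_finite_induct) (simp_all add: bit_sign_add del: add_bit_eq_xor)

lemma sign_char_eq_prod_bit_sign: "sign_char J v = (\<Prod>j\<in>J. bit_sign (v $ j))"
  by (simp add: sign_char_def bit_sign_def)

text \<open>Expanding the product of sums chooses one \<open>b\<close> per coordinate, and these
  choices together form a vector.\<close>

lemma sum_vec_prod:
  fixes h :: "'n::finite \<Rightarrow> 'b::finite \<Rightarrow> 'a::comm_semiring_1"
  shows "(\<Sum>v\<in>(UNIV :: ('b ^ 'n) set). \<Prod>j\<in>UNIV. h j (v $ j)) = (\<Prod>j\<in>UNIV. \<Sum>b\<in>UNIV. h j b)"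
proof -
  have "(\<Prod>j\<in>UNIV. \<Sum>b\<in>UNIV. h j b) = (\<Sum>g\<in>UNIV. \<Prod>j\<in>UNIV. h j (g j))"
    using prod_sum_PiE[of UNIV "\<lambda>_. UNIV" h] by (simp add: PiE_UNIV_domain)
  also have "\<dots> = (\<Sum>v\<in>(UNIV :: ('b ^ 'n) set). \<Prod>j\<in>UNIV. h j (v $ j))"
    by (rule sum.reindex_bij_witness[of _ "vec_nth" "vec_lambda"]) (simp_all add: vec_lambda_inverse)
  finally show ?thesis by simp
qed

lemma prod_weight:
  fixes v :: "bit ^ 'n" and a b :: "'a::comm_monoid_mult"
  shows "(\<Prod>j\<in>UNIV. if v $ j = 0 then a else b) = a ^ (CARD('n) - wt v) * b ^ wt v"
proof -
  have "{j. v $ j = 0} = UNIV - {j. v $ j \<noteq> 0}"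
    by auto
  then have "card {j. v $ j = 0} = CARD('n) - wt v"
    unfolding wt_def by (metis card_Diff_subset finite subset_UNIV)
  then show ?thesis
    by (simp only: prod.If_cases[OF finite] prod_constant wt_def Collect_neg_eq Int_UNIV_left)
qed

section \<open>Tensor powers\<close>

text \<open>The tensor power of \<open>m\<close> in coordinates: its entry at row \<open>w\<close>
  and column \<open>v\<close> is the product of the entries of \<open>m\<close> picked out by the
  coordinates.\<close>

definition tensor_op :: "(bit \<Rightarrow> bit \<Rightarrow> complex) \<Rightarrow> (bit ^ 'n \<Rightarrow> complex) \<Rightarrow> bit ^ 'n \<Rightarrow> complex"
  where "tensor_op m f w = (\<Sum>v\<in>UNIV. (\<Prod>j\<in>UNIV. m (w $ j) (v $ j)) * f v)"

lemma tensor_op_0: "tensor_op m 0 w = 0"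
  by (simp add: tensor_op_def)

lemma tensor_op_scale_add:
  "tensor_op m (fun_scale c f + g) w = c * tensor_op m f w + tensor_op m g w"
  by (simp add: tensor_op_def fun_scale_def sum_distrib_left sum.distrib algebra_simps)

lemma tensor_op_sum: "tensor_op m (\<Sum>i\<in>I. f i) w = (\<Sum>i\<in>I. tensor_op m (f i) w)"
  unfolding tensor_op_def sum_apply sum_distrib_left by (rule sum.swap)

lemma tensor_op_row_scale:
  "tensor_op (\<lambda>a b. r a * m a b) f w = (\<Prod>j\<in>UNIV. r (w $ j)) * tensor_op m f w"
  by (simp add: tensor_op_def prod.distrib sum_distrib_left mult.assoc)

text \<open>Rows summing to 1 fix the constant function, so coordinates outside \<open>J\<close>
  contribute the factor 1, and each one in \<open>J\<close> contributes the image of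
  \<open>bit_sign\<close> under \<open>m\<close>.\<close>

lemma tensor_op_sign_char:
  fixes J :: "'n::finite set"
  assumes "\<And>a. m a 0 + m a 1 = 1"
  shows "tensor_op m (sign_char J) w = (\<Prod>j\<in>J. m (w $ j) 0 - m (w $ j) 1)"
proof -
  have "tensor_op m (sign_char J) w =
      (\<Sum>v\<in>UNIV. \<Prod>j\<in>UNIV. m (w $ j) (v $ j) * (if j \<in> J then bit_sign (v $ j) else 1))"
    by (simp add: tensor_op_def sign_char_eq_prod_bit_sign prod.distrib prod.If_cases)
  also have "\<dots> = (\<Prod>j\<in>UNIV. \<Sum>b\<in>UNIV. m (w $ j) b * (if j \<in> J then bit_sign b else 1))"
    by (rule sum_vec_prod)
  also have "\<dots> = (\<Prod>j\<in>UNIV. if j \<in> J then m (w $ j) 0 - m (w $ j) 1 else 1)"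
    by (rule prod.cong) (auto simp: UNIV_bit assms)
  also have "\<dots> = (\<Prod>j\<in>J. m (w $ j) 0 - m (w $ j) 1)"
    by (simp add: prod.If_cases)
  finally show ?thesis .
qed

text \<open>The matrix fixing the constant function and sending \<^const>\<open>bit_sign\<close> to \<open>t + \<beta> * bit_sign\<close>.\<close>

definition affine_kernel :: "complex \<Rightarrow> complex \<Rightarrow> bit \<Rightarrow> bit \<Rightarrow> complex"
  where "affine_kernel \<beta> t a b = (1 + (t + \<beta> * bit_sign a) * bit_sign b) / 2"

lemma tensor_op_affine_kernel_sign_char:
  fixes J :: "'n::finite set"
  shows "tensor_op (affine_kernel \<beta> t) (sign_char J) w = (\<Prod>j\<in>J. t + \<beta> * bit_sign (w $ j))"
  by (subst tensor_op_sign_char)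
    (simp_all add: affine_kernel_def diff_divide_distrib add_divide_distrib algebra_simps)

text \<open>At \<open>t = 0\<close> the matrix has \<open>bit_sign\<close> as an eigenvector with
  eigenvalue \<open>\<beta>\<close>, so each \<open>sign_char J\<close> collects one
  \<open>\<beta>\<close> per element of \<open>J\<close>.\<close>

lemma tensor_op_affine_kernel_0:
  assumes "f \<in> disc_poly d"
  shows "tensor_op (affine_kernel \<beta> 0) f w = \<beta> ^ d * f w"
  using assms unfolding disc_poly_def
proof (induction rule: cfun.span_induct_alt)
  case base
  show ?case
    unfolding tensor_op_0 by simp
next
  case (step c g h)
  then obtain J where "g = sign_char J" "card J = d"
    by blast
  then have "tensor_op (affine_kernel \<beta> 0) g w = \<beta> ^ d * g w"
    by (simp add: tensor_op_affine_kernel_sign_char sign_char_eq_prod_bit_sign prod.distrib)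
  with step show ?case
    unfolding tensor_op_scale_add by (simp add: fun_scale_def algebra_simps)
qed

lemma DERIV_tensor_op_affine_kernel:
  assumes "f \<in> disc_poly d"
  shows "((\<lambda>t. tensor_op (affine_kernel \<beta> t) f w) has_field_derivative
      tensor_op (affine_kernel \<beta> t) (X'_tilde f) w) (at t)"
  using assms unfolding disc_poly_def
proof (induction rule: cfun.span_induct_alt)
  case base
  show ?case
    unfolding X'_tilde_zero tensor_op_0 by simp
next
  case (step c g h)
  then obtain J where J: "g = sign_char J"
    by blast
  \<comment> \<open>Each factor \<open>t + \<beta> * bit_sign (w $ j)\<close> has derivative 1, so
    the product rule deletes one index of \<open>J\<close> at a time, just as
    \<open>X'_tilde\<close> does to \<open>sign_char J\<close>.\<close>
  have "((\<lambda>t. tensor_op (affine_kernel \<beta> t) g w) has_field_derivative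
      tensor_op (affine_kernel \<beta> t) (X'_tilde g) w) (at t)"
    unfolding J X'_tilde_sign_char tensor_op_sum tensor_op_affine_kernel_sign_char
    by (rule has_field_derivative_prod[where f' = "\<lambda>_. 1", unfolded mult_1])
      (auto intro!: derivative_eq_intros)
  with step show ?case
    unfolding X'_tilde_add X'_tilde_scale tensor_op_scale_add
    by (auto intro!: derivative_eq_intros)
qed

lemma tensor_op_affine_kernel_harmonic:
  assumes "Q \<in> disc_harmonic d"
  shows "tensor_op (affine_kernel \<beta> t) Q w = \<beta> ^ d * Q w"
proof -
  have Q: "Q \<in> disc_poly d" "X'_tilde Q = 0"
    using assms by (auto simp: disc_harmonic_def)
  have "((\<lambda>t. tensor_op (affine_kernel \<beta> t) Q w) has_field_derivative 0) (at s)" for s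
    using DERIV_tensor_op_affine_kernel[OF Q(1), of \<beta> w s] unfolding Q(2) tensor_op_0 .
  then obtain c where "\<And>s. tensor_op (affine_kernel \<beta> s) Q w = c"
    using has_field_derivative_zero_constant[of UNIV "\<lambda>t. tensor_op (affine_kernel \<beta> t) Q w"]
    by auto
  then show ?thesis
    using tensor_op_affine_kernel_0[OF Q(1)] by metis
qed

section \<open>Poisson summation\<close>

definition code_char :: "bit ^ 'n \<Rightarrow> bit ^ 'n \<Rightarrow> complex"
  where "code_char v w = (\<Prod>j\<in>UNIV. bit_sign (v $ j * w $ j))"

definition fourier :: "(bit ^ 'n \<Rightarrow> complex) \<Rightarrow> bit ^ 'n \<Rightarrow> complex"
  where "fourier f w = (\<Sum>v\<in>UNIV. code_char v w * f v)"

lemma mem_dual_code_iff: "w \<in> dual_code C \<longleftrightarrow> (\<forall>c\<in>C. code_char c w = 1)"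
  unfolding dual_code_def code_char_def bit_sign_sum[symmetric] bit_sign_eq_1_iff by simp

lemma code_char_cases: "code_char v w = 1 \<or> code_char v w = - 1"
  unfolding code_char_def bit_sign_sum[symmetric] by (simp add: bit_sign_def)

lemma code_char_add: "code_char (u + v) w = code_char u w * code_char v w"
  unfolding code_char_def prod.distrib[symmetric] bit_sign_add[symmetric]
  by (simp only: vector_add_component distrib_right)

lemma code_char_commute: "code_char v w = code_char w v"
  by (simp only: code_char_def mult.commute)

lemma sum_code_char:
  assumes "vec.subspace C"
  shows "(\<Sum>c\<in>C. code_char c w) = (if w \<in> dual_code C then of_nat (card C) else 0)"
proof (cases "w \<in> dual_code C")
  case True
  then show ?thesis
    by (simp add: mem_dual_code_iff)
next
  case False
  then obtain u where u: "u \<in> C" "code_char u w = - 1"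
    using code_char_cases by (auto simp: mem_dual_code_iff)
  \<comment> \<open>Translation by \<open>u\<close> permutes \<open>C\<close> and flips the sign of
    every term, so the sum equals its own negative.\<close>
  have "(\<Sum>c\<in>C. code_char c w) = (\<Sum>c\<in>C. code_char (u + c) w)"
    by (rule sum.reindex_bij_witness[of _ "\<lambda>c. u + c" "\<lambda>c. c - u"])
      (auto intro: vec.subspace_add vec.subspace_diff assms u)
  also have "\<dots> = - (\<Sum>c\<in>C. code_char c w)"
    by (simp add: code_char_add u sum_negf)
  finally show ?thesis
    using False by simp
qed

lemma dual_code_UNIV: "dual_code UNIV = {0 :: bit ^ 'n}"
proof -
  have "w = 0" if "w \<in> dual_code UNIV" for w :: "bit ^ 'n"
  proof (subst vec_eq_iff, rule allI)
    fix i
    \<comment> \<open>Pairing with the unit vector \<open>axis i 1\<close> isolates the coordinate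
      \<open>i\<close> of \<open>w\<close>.\<close>
    have "(\<Prod>j\<in>UNIV. bit_sign (axis i 1 $ j * w $ j)) = 1"
      using that by (simp add: mem_dual_code_iff code_char_def)
    also have "(\<Prod>j\<in>UNIV. bit_sign (axis i 1 $ j * w $ j))
        = (\<Prod>j\<in>UNIV. if j = i then bit_sign (w $ j) else 1)"
      by (rule prod.cong) (auto simp: axis_def)
    finally show "w $ i = 0 $ i"
      by (simp add: bit_sign_eq_1_iff)
  qed
  then show ?thesis
    by (auto simp: dual_code_def)
qed

lemma sum_code_char_UNIV:
  "(\<Sum>w\<in>(UNIV :: (bit ^ 'n) set). code_char w v) = (if v = 0 then 2 ^ CARD('n) else 0)"
  using sum_code_char[OF vec.subspace_UNIV, of v]
  by (simp add: dual_code_UNIV CARD_vec UNIV_bit[THEN arg_cong[where f=card]])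

text \<open>Fourier inversion. The transform is its own inverse up to \<open>2 ^ CARD('n)\<close>,
  because \<open>c - v\<close> and \<open>c + v\<close> agree over the two-element field.\<close>

lemma sum_code_char_fourier:
  fixes f :: "bit ^ 'n \<Rightarrow> complex"
  shows "(\<Sum>w\<in>UNIV. code_char c w * fourier f w) = 2 ^ CARD('n) * f c"
proof -
  have "(\<Sum>w\<in>UNIV. code_char c w * fourier f w)
      = (\<Sum>w\<in>UNIV. \<Sum>v\<in>UNIV. code_char w (c + v) * f v)"
    by (simp add: fourier_def sum_distrib_left code_char_commute[of _ "c + _"] code_char_add mult.assoc)
  also have "\<dots> = (\<Sum>v\<in>UNIV. (\<Sum>w\<in>UNIV. code_char w (c + v)) * f v)"
    unfolding sum_distrib_right by (rule sum.swap)
  also have "\<dots> = (\<Sum>v\<in>UNIV. if c = v then 2 ^ CARD('n) * f v else 0)"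
  proof (rule sum.cong)
    fix v
    have "a + b = 0 \<longleftrightarrow> a = b" for a b :: bit
      by (cases a; cases b) simp_all
    then have "c + v = 0 \<longleftrightarrow> c = v"
      by (simp add: vec_eq_iff)
    then show "(\<Sum>w\<in>UNIV. code_char w (c + v)) * f v = (if c = v then 2 ^ CARD('n) * f v else 0)"
      by (simp add: sum_code_char_UNIV)
  qed simp
  finally show ?thesis
    by simp
qed

text \<open>By \<open>sum_code_char\<close>, \<open>card C\<close> times the indicator of the dual
  code is a sum of characters over \<open>C\<close>; after swapping the sums, inversion applies to
  each \<open>c\<close>.\<close>

lemma card_mult_sum_dual_fourier:
  fixes f :: "bit ^ 'n \<Rightarrow> complex"
  assumes "vec.subspace C"
  shows "of_nat (card C) * (\<Sum>w\<in>dual_code C. fourier f w) = 2 ^ CARD('n) * (\<Sum>c\<in>C. f c)"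
proof -
  have "of_nat (card C) * (\<Sum>w\<in>dual_code C. fourier f w)
      = (\<Sum>w\<in>UNIV. (\<Sum>c\<in>C. code_char c w) * fourier f w)"
    by (simp add: sum_code_char[OF assms] sum_distrib_left if_distrib[of "\<lambda>z. z * _"]
        sum.If_cases cong: if_cong)
  also have "\<dots> = (\<Sum>c\<in>C. \<Sum>w\<in>UNIV. code_char c w * fourier f w)"
    unfolding sum_distrib_right by (rule sum.swap)
  finally show ?thesis
    by (simp add: sum_code_char_fourier sum_distrib_left)
qed

lemma card_mult_card_dual_code:
  fixes C :: "(bit ^ 'n) set"
  assumes "vec.subspace C"
  shows "(of_nat (card C) * of_nat (card (dual_code C)) :: complex) = 2 ^ CARD('n)"
proof -
  \<comment> \<open>The point mass at 0 has constant transform 1, so its sum over the dual code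
    counts codewords, while its sum over \<open>C\<close> is 1.\<close>
  let ?\<delta> = "\<lambda>v :: bit ^ 'n. if v = 0 then 1 else 0"
  have "fourier ?\<delta> w = 1" for w
    by (simp add: fourier_def code_char_def if_distrib[of "\<lambda>z. _ * z"] cong: if_cong)
  then show ?thesis
    using card_mult_sum_dual_fourier[OF assms, of ?\<delta>] vec.subspace_0[OF assms]
    by (simp add: sum.delta)
qed

lemma poisson_summation:
  fixes f :: "bit ^ 'n \<Rightarrow> complex"
  assumes "vec.subspace C"
  shows "(\<Sum>c\<in>C. f c) = (\<Sum>w\<in>dual_code C. fourier f w) / of_nat (card (dual_code C))"
proof -
  have "(of_nat (card C) :: complex) \<noteq> 0" "(of_nat (card (dual_code C)) :: complex) \<noteq> 0"
    using card_mult_card_dual_code[OF assms] by auto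
  then show ?thesis
    using card_mult_sum_dual_fourier[OF assms, of f]
    by (simp add: card_mult_card_dual_code[OF assms, symmetric] field_simps)
qed

section \<open>Harmonic weight enumerators\<close>

text \<open>Both the character and the weight monomial are products over coordinates, so together
  they form the kernel of a tensor power, with rows \<open>(x, y)\<close> and
  \<open>(x, - y)\<close>.\<close>

lemma fourier_weighted:
  fixes f :: "bit ^ 'n \<Rightarrow> complex"
  shows "fourier (\<lambda>v. f v * x ^ (CARD('n) - wt v) * y ^ wt v) w
    = tensor_op (\<lambda>a b. if b = 0 then x else y * bit_sign a) f w"
proof -
  have "code_char v w * (x ^ (CARD('n) - wt v) * y ^ wt v)
      = (\<Prod>j\<in>UNIV. if v $ j = 0 then x else y * bit_sign (w $ j))" for v
    unfolding code_char_def prod_weight[symmetric] prod.distrib[symmetric] by (rule prod.cong) auto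
  then show ?thesis
    unfolding fourier_def tensor_op_def by (intro sum.cong) (simp_all add: mult.assoc mult.left_commute[of _ "f _"] mult.commute[of _ "f _"])
qed

lemma fourier_weighted_harmonic:
  fixes Q :: "bit ^ 'n \<Rightarrow> complex"
  assumes "Q \<in> disc_harmonic d" and "x\<^sup>2 \<noteq> y\<^sup>2"
  shows "fourier (\<lambda>v. Q v * x ^ (CARD('n) - wt v) * y ^ wt v) w
    = (- 2 * (x * y / (x\<^sup>2 - y\<^sup>2))) ^ d * (Q w * (x + y) ^ (CARD('n) - wt w) * (x - y) ^ wt w)"
proof -
  \<comment> \<open>The rows \<open>(x, y)\<close> and \<open>(x, - y)\<close> have sums
    \<open>x + y\<close> and \<open>x - y\<close>. Dividing by these sums, nonzero as
    \<open>x\<^sup>2 \<noteq> y\<^sup>2\<close>, leaves the entry differences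
    \<open>(x - y) / (x + y)\<close> and \<open>(x + y) / (x - y)\<close>. They must equal
    \<open>?\<alpha> + ?\<beta>\<close> and \<open>?\<alpha> - ?\<beta>\<close>, which determines
    both constants.\<close>
  let ?\<alpha> = "(x\<^sup>2 + y\<^sup>2) / (x\<^sup>2 - y\<^sup>2)" and ?\<beta> = "- 2 * (x * y / (x\<^sup>2 - y\<^sup>2))"
  let ?r = "\<lambda>a. if a = 0 then x + y else x - y"
  have sq: "x\<^sup>2 - y\<^sup>2 = (x + y) * (x - y)"
    by (simp add: power2_eq_square algebra_simps)
  then have nz: "x + y \<noteq> 0" "x - y \<noteq> 0"
    using assms(2) by auto
  have p: "?\<alpha> + ?\<beta> = (x - y) / (x + y)" and q: "?\<alpha> - ?\<beta> = (x + y) / (x - y)"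
    using nz unfolding sq by (simp_all add: divide_simps) (simp_all add: power2_eq_square algebra_simps)
  have "?r a * affine_kernel ?\<beta> ?\<alpha> a b = (if b = 0 then x else y * bit_sign a)" for a b
  proof (cases a)
    case zero
    have k: "affine_kernel ?\<beta> ?\<alpha> a b = (1 + (x - y) / (x + y) * bit_sign b) / 2"
      unfolding affine_kernel_def zero p[symmetric] by simp
    have "(x + y) * ((1 + (x - y) / (x + y) * bit_sign b) / 2) = ((x + y) + (x - y) * bit_sign b) / 2"
      using nz by (simp add: distrib_left)
    then show ?thesis
      unfolding k using zero by (cases b) simp_all
  next
    case one
    have k: "affine_kernel ?\<beta> ?\<alpha> a b = (1 + (x + y) / (x - y) * bit_sign b) / 2"
      unfolding affine_kernel_def one q[symmetric] by simp
    have "(x - y) * ((1 + (x + y) / (x - y) * bit_sign b) / 2) = ((x - y) + (x + y) * bit_sign b) / 2"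
      using nz by (simp add: distrib_left)
    then show ?thesis
      unfolding k using one by (cases b) (simp_all add: field_simps)
  qed
  then have "(\<lambda>a b. ?r a * affine_kernel ?\<beta> ?\<alpha> a b) = (\<lambda>a b. if b = 0 then x else y * bit_sign a)"
    by (intro ext)
  then have "tensor_op (\<lambda>a b. if b = 0 then x else y * bit_sign a) Q w
      = (\<Prod>j\<in>UNIV. ?r (w $ j)) * tensor_op (affine_kernel ?\<beta> ?\<alpha>) Q w"
    using tensor_op_row_scale[of ?r "affine_kernel ?\<beta> ?\<alpha>" Q w] by (simp only:)
  then show ?thesis
    unfolding fourier_weighted tensor_op_affine_kernel_harmonic[OF assms(1)] prod_weight
    by (simp only: mult_ac)
qed

lemma weight_enum_scale:
  fixes C :: "(bit ^ 'n) set"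
  shows "weight_enum C Q (x / s) (y / s) = weight_enum C Q x y / s ^ CARD('n)"
proof -
  \<comment> \<open>Homogeneity of degree \<open>CARD('n)\<close> needs this bound, since the
    exponent \<open>CARD('n) - wt c\<close> is a truncated difference.\<close>
  have "wt c \<le> CARD('n)" for c :: "bit ^ 'n"
    unfolding wt_def by (rule card_mono) auto
  then have "s ^ CARD('n) = s ^ (CARD('n) - wt c) * s ^ wt c" for c :: "bit ^ 'n"
    by (simp flip: power_add)
  then show ?thesis
    unfolding weight_enum_def sum_divide_distrib
    by (intro sum.cong) (simp_all add: power_divide)
qed

theorem theorem5p1:
  fixes C :: "(bit ^ 'n) set" and d :: nat and Q :: "bit ^ 'n \<Rightarrow> complex" and x y :: complex
  assumes "vec.subspace C"
    and "Q \<in> disc_harmonic d"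
    and "x\<^sup>2 \<noteq> y\<^sup>2"
  shows "weight_enum C Q x y =
    (- (x * y / (x\<^sup>2 - y\<^sup>2))) ^ d
    * (complex_of_real (2 powr (real CARD('n) / 2 + real d)) / of_nat (card (dual_code C)))
    * weight_enum (dual_code C) Q
        ((x + y) / complex_of_real (sqrt 2)) ((x - y) / complex_of_real (sqrt 2))"
proof -
  let ?z = "x * y / (x\<^sup>2 - y\<^sup>2)"
  \<comment> \<open>The half power of 2 only undoes the rescaling of both arguments by
    \<open>sqrt 2\<close>; the remaining \<open>2 ^ d\<close> comes from the factor 2 in
    \<open>\<beta>\<close>.\<close>
  have "sqrt 2 ^ CARD('n) = 2 powr (real CARD('n) / 2)"
    by (simp add: powr_half_sqrt[symmetric] powr_powr flip: powr_realpow)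
  then have "2 powr (real CARD('n) / 2 + real d) = sqrt 2 ^ CARD('n) * 2 ^ d"
    by (simp add: powr_add powr_realpow)
  then have pow: "complex_of_real (2 powr (real CARD('n) / 2 + real d))
      = complex_of_real (sqrt 2) ^ CARD('n) * 2 ^ d"
    by simp
  have "weight_enum C Q x y
      = (- 2 * ?z) ^ d * weight_enum (dual_code C) Q (x + y) (x - y) / of_nat (card (dual_code C))"
    unfolding weight_enum_def poisson_summation[OF assms(1)]
      fourier_weighted_harmonic[OF assms(2,3)] sum_distrib_left ..
  also have "(- 2 * ?z) ^ d = (- ?z) ^ d * 2 ^ d"
    by (simp only: mult_minus_left mult_minus_right mult.commute flip: power_mult_distrib)
  finally show ?thesis
    unfolding weight_enum_scale pow by simp
qed

end
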